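(* Let $k\ge 2$ be an integer, let $P$ be a $(k-1)$-dimensional polytope with $p\in P$, and let $\mathcal{M}$ be a matroid of rank $k$ on a finite ground set $W$ with rank function $r$. Assume that for every $\tau\in F(P)$ we are given points $\{y_\tau^w \mid w\in W\}$, each contained in $\tau$, and we are given an $\mathcal{M}$-Komiya cover $(A^w_\tau \mid w\in W,\ \tau\in F(P))$ of $P$. Let $T$ be a convex triangulation of $P$. Then there exist a triangulation $T'$ of $P$ refining $T$ and maps $\lambda: V(T')\to F(P)$, $f:V(T')\to W$ and $y:V(T')\to P$ such that: (P1) $v\in A^{f(v)}_{\lambda(v)}$ for every $v\in V(T')$; (P2) $y(v)=y^{f(v)}_{\lambda(v)}\in\lambda(v)\subseteq \mathrm{supp}(v)$ for every $v\in V(T')$; (P3) for every face $\tau$ of $T'$, the map $f$ is injective on the vertices of $\tau$ and $\{f(v) : v\in V(\tau)\}$ is an independent set of $\mathcal{M}$ (so it is a basis of $\mathcal{M}$ whenever $\tau$ has $k$ vertices). In particular, $\lambda$ is a Sperner–Shapley labeling of $T'$.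
   Context: $F(P)$ is the set of nonempty faces of $P$. For $v\in P$, $\mathrm{supp}(v)$ is the minimal face of $P$ containing $v$. $V(T)$ denotes the vertex set of a triangulation $T$. A Komiya cover of $P$ is a family $(A_\sigma\mid\sigma\in F(P))$ of closed subsets of $P$ such that $\tau\subseteq\bigcup_{\sigma\subseteq\tau}A_\sigma$ for every $\tau\in F(P)$. A family of closed sets $(A_\sigma^w\mid w\in W,\sigma\in F(P))$ is an $\mathcal{M}$-Komiya cover if for every $G\subseteq W$ with $r(W\setminus G)\le k-1$, the family $\left(\bigcup_{w\in G}A^w_\sigma\mid\sigma\in F(P)\right)$ is a Komiya cover of $P$; $r$ is the matroid rank function (size of a largest independent subset). A Sperner–Shapley labeling of a triangulation $T$ of $P$ is a map $\lambda:V(T)\to F(P)$ with $\lambda(v)\subseteq\mathrm{supp}(v)$ for all $v$. *)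

theory Defs
  imports "HOL-Analysis.Analysis"
begin

locale matroid =
  fixes carrier :: "'w set" and indep :: "'w set \<Rightarrow> bool"
  assumes finite_carrier: "finite carrier"
    and indep_subset_carrier: "indep X \<Longrightarrow> X \<subseteq> carrier"
    and indep_empty: "indep {}"
    and indep_subset: "indep X \<Longrightarrow> Y \<subseteq> X \<Longrightarrow> indep Y"
    and augment: "indep X \<Longrightarrow> indep Y \<Longrightarrow> card X < card Y \<Longrightarrow> \<exists>y\<in>Y - X. indep (insert y X)"

definition matroid_rank :: "('w set \<Rightarrow> bool) \<Rightarrow> 'w set \<Rightarrow> nat" where
  "matroid_rank indep X = Max (card ` {I. I \<subseteq> X \<and> indep I})"

definition matroid_basis :: "('w set \<Rightarrow> bool) \<Rightarrow> 'w set \<Rightarrow> bool" where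
  "matroid_basis indep B \<longleftrightarrow> indep B \<and> (\<forall>I. indep I \<and> B \<subseteq> I \<longrightarrow> I = B)"

definition nonempty_faces :: "'a::euclidean_space set \<Rightarrow> 'a set set" where
  "nonempty_faces P = {\<sigma>. \<sigma> face_of P \<and> \<sigma> \<noteq> {}}"

text \<open>The least element is taken with respect to inclusion.\<close>

definition supp :: "'a::euclidean_space set \<Rightarrow> 'a \<Rightarrow> 'a set" where
  "supp P v = (LEAST \<sigma>. \<sigma> face_of P \<and> v \<in> \<sigma>)"

lemma supp_eq_Inter:
  fixes P :: "'a::euclidean_space set"
  assumes "convex P" "v \<in> P"
  shows "supp P v = \<Inter>{\<sigma>. \<sigma> face_of P \<and> v \<in> \<sigma>}"
  unfolding supp_def
proof (rule Least_equality)
  have "P \<in> {\<sigma>. \<sigma> face_of P \<and> v \<in> \<sigma>}"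
    using assms face_of_refl by auto
  then have "\<Inter>{\<sigma>. \<sigma> face_of P \<and> v \<in> \<sigma>} face_of P"
    by (intro face_of_Inter) auto
  then show "\<Inter>{\<sigma>. \<sigma> face_of P \<and> v \<in> \<sigma>} face_of P \<and> v \<in> \<Inter>{\<sigma>. \<sigma> face_of P \<and> v \<in> \<sigma>}"
    by auto
qed auto

text \<open>Triangulations are geometric: finite, face-closed complexes whose members are convex hulls of
  affinely independent finite sets. Hence every simplex is convex, and this is how the word
  ``convex'' in ``convex triangulation'' is read. The empty simplex is a member of the complex.\<close>

definition triangulation_of :: "'a::euclidean_space set \<Rightarrow> 'a set set \<Rightarrow> bool" where
  "triangulation_of P T \<longleftrightarrow> simplicial_complex T \<and> \<Union>T = P"

definition simplex_vertices :: "'a::euclidean_space set \<Rightarrow> 'a set" where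
  "simplex_vertices \<tau> = {v. v extreme_point_of \<tau>}"

definition triangulation_vertices :: "'a::euclidean_space set set \<Rightarrow> 'a set" where
  "triangulation_vertices T = (\<Union>\<tau>\<in>T. simplex_vertices \<tau>)"

definition triangulation_refines :: "'a::euclidean_space set set \<Rightarrow> 'a set set \<Rightarrow> bool" where
  "triangulation_refines T' T \<longleftrightarrow>
     (\<forall>\<tau>'\<in>T'. \<exists>\<tau>\<in>T. \<tau>' \<subseteq> \<tau>) \<and> (\<forall>\<tau>\<in>T. \<exists>F\<subseteq>T'. \<tau> = \<Union>F)"

definition komiya_cover :: "'a::euclidean_space set \<Rightarrow> ('a set \<Rightarrow> 'a set) \<Rightarrow> bool" where
  "komiya_cover P A \<longleftrightarrow>
     (\<forall>\<sigma>\<in>nonempty_faces P. closed (A \<sigma>) \<and> A \<sigma> \<subseteq> P) \<and>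
     (\<forall>\<tau>\<in>nonempty_faces P. \<tau> \<subseteq> (\<Union>\<sigma>\<in>{\<sigma>\<in>nonempty_faces P. \<sigma> \<subseteq> \<tau>}. A \<sigma>))"

text \<open>Here \<open>k\<close> is the rank of the matroid. The case \<open>G = W\<close> forces every \<open>A w \<sigma>\<close> to be a subset
  of \<open>P\<close>.\<close>

definition matroid_komiya_cover ::
  "nat \<Rightarrow> 'w set \<Rightarrow> ('w set \<Rightarrow> bool) \<Rightarrow> 'a::euclidean_space set \<Rightarrow> ('w \<Rightarrow> 'a set \<Rightarrow> 'a set) \<Rightarrow> bool"
  where
  "matroid_komiya_cover k W indep P A \<longleftrightarrow>
     (\<forall>w\<in>W. \<forall>\<sigma>\<in>nonempty_faces P. closed (A w \<sigma>)) \<and>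
     (\<forall>G\<subseteq>W. matroid_rank indep (W - G) \<le> k - 1 \<longrightarrow> komiya_cover P (\<lambda>\<sigma>. \<Union>w\<in>G. A w \<sigma>))"

definition sperner_shapley_labeling ::
  "'a::euclidean_space set \<Rightarrow> 'a set set \<Rightarrow> ('a \<Rightarrow> 'a set) \<Rightarrow> bool" where
  "sperner_shapley_labeling P T lab \<longleftrightarrow>
     (\<forall>v\<in>triangulation_vertices T. lab v \<in> nonempty_faces P \<and> lab v \<subseteq> supp P v)"

end

theory Submission
  imports Defs "HOL-Library.Multiset"
begin

text \<open>At every point of \<open>P\<close> the labels available there span the matroid. The vertices of \<open>T\<close> are
  labelled one after the other, with stellar subdivisions on the way, so that the simplices spanned
  by labelled vertices always have independent labels.

  When a vertex \<open>y\<close> gets its label, a simplex \<open>S\<close> of labelled vertices that becomes a circuit is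
  starred at its barycenter \<open>z\<close>; this destroys all simplices containing \<open>S\<close>, and \<open>z\<close> is a new
  unlabelled vertex. Each unlabelled vertex \<open>u\<close> carries a set \<open>F u\<close> of labels whose span its own
  label has to avoid: \<open>F\<close> is empty on the vertices of \<open>T\<close>, and \<open>F z\<close> consists of \<open>F y\<close> and the labels
  of \<open>S - {y}\<close>. Since the label of \<open>y\<close> lies outside the span of \<open>F y\<close> but inside that of the
  labels of \<open>S - {y}\<close>, the rank of \<open>F z\<close> exceeds that of \<open>F y\<close>. So each step replaces an
  unlabelled vertex by finitely many of higher rank, and the process stops.\<close>

section \<open>Matroid rank\<close>

context matroid
begin

abbreviation rk :: "'w set \<Rightarrow> nat" where
  "rk \<equiv> matroid_rank indep"

lemma finite_indep: "indep I \<Longrightarrow> finite I"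
  using finite_carrier finite_subset indep_subset_carrier by blast

lemma finite_card_indep_subsets: "finite (card ` {I. I \<subseteq> X \<and> indep I})"
proof -
  have "{I. I \<subseteq> X \<and> indep I} \<subseteq> Pow carrier"
    using indep_subset_carrier by auto
  then show ?thesis
    using finite_carrier finite_subset by blast
qed

lemma card_le_rank: "indep I \<Longrightarrow> I \<subseteq> X \<Longrightarrow> card I \<le> rk X"
  unfolding matroid_rank_def by (rule Max_ge[OF finite_card_indep_subsets]) auto

lemma rank_witness:
  obtains I where "indep I" "I \<subseteq> X" "card I = rk X"
proof -
  have "rk X \<in> card ` {I. I \<subseteq> X \<and> indep I}"
    unfolding matroid_rank_def
    by (rule Max_in[OF finite_card_indep_subsets]) (use indep_empty in auto)
  then show thesis using that by auto
qed

lemma rank_mono: "X \<subseteq> Y \<Longrightarrow> rk X \<le> rk Y"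
  by (metis card_le_rank order_trans rank_witness)

lemma rank_le_rank_carrier: "rk X \<le> rk carrier"
  by (metis card_le_rank indep_subset_carrier rank_witness)

lemma rank_le_card: "finite X \<Longrightarrow> rk X \<le> card X"
  by (metis card_mono rank_witness)

lemma rank_indep: "indep I \<Longrightarrow> rk I = card I"
  by (simp add: card_le_rank finite_indep le_antisym rank_le_card)

lemma indep_if_rank_eq_card: "finite X \<Longrightarrow> rk X = card X \<Longrightarrow> indep X"
  by (metis card_subset_eq rank_witness)

text \<open>Take an independent set between \<open>I\<close> and \<open>X\<close> of largest
  cardinality. If it were smaller than \<open>rk X\<close>, augmenting it from a largest independent
  subset of \<open>X\<close> would enlarge it within \<open>X\<close>.\<close>

lemma indep_extend:
  assumes "indep I" "I \<subseteq> X"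
  obtains J where "indep J" "I \<subseteq> J" "J \<subseteq> X" "card J = rk X"
proof -
  let ?Q = "\<lambda>J. indep J \<and> I \<subseteq> J \<and> J \<subseteq> X"
  obtain J where J: "?Q J" "\<And>J'. ?Q J' \<Longrightarrow> card J' \<le> card J"
    using ex_has_greatest_nat[of ?Q I card "Suc (rk X)"] assms card_le_rank
    by (metis le_imp_less_Suc order_refl)
  obtain B where B: "indep B" "B \<subseteq> X" "card B = rk X"
    by (rule rank_witness)
  have "\<not> card J < card B"
  proof
    assume "card J < card B"
    then obtain b where b: "b \<in> B - J" "indep (insert b J)"
      using augment J(1) B(1) by blast
    then have "card (insert b J) \<le> card J"
      using J B(2) by blast
    then show False
      using b J(1) finite_indep by simp
  qed
  then have "card J = rk X"
    using B(3) J(1) card_le_rank by (metis le_antisym not_less)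
  then show thesis using that J(1) by blast
qed

text \<open>A basis of \<open>X \<inter> Y\<close> is extended to a basis \<open>J\<close> of
  \<open>X \<union> Y\<close>. The traces of \<open>J\<close> on \<open>X\<close> and
  \<open>Y\<close> are independent, and inclusion-exclusion on \<open>J\<close> gives the
  inequality.\<close>

lemma rank_submodular: "rk (X \<union> Y) + rk (X \<inter> Y) \<le> rk X + rk Y"
proof -
  obtain I where I: "indep I" "I \<subseteq> X \<inter> Y" "card I = rk (X \<inter> Y)"
    by (rule rank_witness)
  then obtain J where J: "indep J" "I \<subseteq> J" "J \<subseteq> X \<union> Y" "card J = rk (X \<union> Y)"
    by (metis indep_extend le_supI1 le_inf_iff)
  have fin: "finite (J \<inter> X)" "finite (J \<inter> Y)"
    using J(1) finite_indep by auto
  have "(J \<inter> X) \<union> (J \<inter> Y) = J" using J(3) by blast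
  moreover have "card I \<le> card ((J \<inter> X) \<inter> (J \<inter> Y))"
    using I(2) J(2) fin by (intro card_mono) auto
  moreover have "card (J \<inter> X) \<le> rk X" "card (J \<inter> Y) \<le> rk Y"
    using J(1) indep_subset by (auto intro!: card_le_rank)
  ultimately show ?thesis
    using card_Un_Int[OF fin] I(3) J(4) by simp
qed

lemma rank_insert_le: "rk (insert c X) \<le> Suc (rk X)"
  using rank_submodular[of "{c}" X] rank_le_card[of "{c}"] by simp

text \<open>Monotonicity of the span: \<open>rk (insert c X) = rk X\<close> expresses that
  \<open>c\<close> lies in the span of \<open>X\<close>. It is submodularity for
  \<open>insert c X\<close> and \<open>Y\<close>.\<close>

lemma rank_insert_absorb:
  assumes "rk (insert c X) = rk X" "X \<subseteq> Y"
  shows "rk (insert c Y) = rk Y"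
proof -
  have "rk (insert c X \<union> Y) + rk (insert c X \<inter> Y) \<le> rk (insert c X) + rk Y"
    by (rule rank_submodular)
  moreover have "insert c X \<union> Y = insert c Y" using assms(2) by blast
  moreover have "rk X \<le> rk (insert c X \<inter> Y)"
    using assms(2) by (intro rank_mono) blast
  moreover have "rk Y \<le> rk (insert c Y)" by (intro rank_mono) blast
  ultimately show ?thesis using assms(1) by simp
qed

text \<open>Augmenting a basis of \<open>F\<close> from a larger basis of \<open>X\<close> yields an
  element of \<open>X\<close> outside the span of \<open>F\<close>. This supplies the label of the
  next vertex.\<close>

lemma rank_increasing_element:
  assumes "rk F < rk X"
  obtains c where "c \<in> X" "rk F < rk (insert c F)"
proof -
  obtain I where I: "indep I" "I \<subseteq> X" "card I = rk X" by (rule rank_witness)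
  obtain J where J: "indep J" "J \<subseteq> F" "card J = rk F" by (rule rank_witness)
  obtain c where c: "c \<in> I - J" "indep (insert c J)"
    using augment[OF J(1) I(1)] assms I(3) J(3) by auto
  have "card (insert c J) \<le> rk (insert c F)"
    using J(2) c(2) by (intro card_le_rank) auto
  then show thesis
    using that[of c] c J finite_indep[OF J(1)] I(2) by auto
qed

section \<open>Rainbow vertex sets\<close>

text \<open>Injectivity makes a repeated label count as a dependence, so this is independence in the
  pullback of the matroid along \<open>f\<close>. On finite sets it amounts to an equation between
  rank and cardinality.\<close>

definition rainbow :: "('v \<Rightarrow> 'w) \<Rightarrow> 'v set \<Rightarrow> bool" where
  "rainbow f A \<longleftrightarrow> inj_on f A \<and> indep (f ` A)"

lemma rainbow_subset: "rainbow f A \<Longrightarrow> B \<subseteq> A \<Longrightarrow> rainbow f B"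
  unfolding rainbow_def by (meson image_mono indep_subset inj_on_subset)

lemma rank_image_le_card: "finite A \<Longrightarrow> rk (f ` A) \<le> card A"
  by (meson card_image_le finite_imageI order_trans rank_le_card)

lemma rainbow_iff_rank: "finite A \<Longrightarrow> rainbow f A \<longleftrightarrow> rk (f ` A) = card A"
  unfolding rainbow_def
  by (metis card_image card_image_le eq_card_imp_inj_on finite_imageI indep_if_rank_eq_card
      le_antisym rank_indep rank_le_card)

lemma rank_insert_not_rainbow:
  assumes "finite A" "rainbow f A" "\<not> rainbow f (insert y A)"
  shows "rk (insert (f y) (f ` A)) = rk (f ` A)"
proof -
  have y: "y \<notin> A" using assms by (metis insert_absorb)
  have "rk (f ` insert y A) \<noteq> Suc (card A)" "rk (f ` A) = card A"
    using assms y rainbow_iff_rank[of "insert y A" f] rainbow_iff_rank[of A f] by auto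
  moreover have "rk (f ` insert y A) \<le> Suc (card A)"
    using rank_image_le_card[of "insert y A" f] assms(1) y by simp
  moreover have "rk (f ` A) \<le> rk (f ` insert y A)" by (intro rank_mono) blast
  ultimately show ?thesis by simp
qed

text \<open>This is the uniqueness of the circuit in an independent set plus one element.\<close>

lemma not_rainbow_insert_Int:
  assumes "finite A" "finite B" "rainbow f (A \<union> B)" "y \<notin> A \<union> B"
    and "\<not> rainbow f (insert y A)" "\<not> rainbow f (insert y B)"
  shows "\<not> rainbow f (insert y (A \<inter> B))"
proof
  assume r: "rainbow f (insert y (A \<inter> B))"
  let ?X = "insert (f y) (f ` A)" and ?Y = "insert (f y) (f ` B)"
  have rAB: "rainbow f A" "rainbow f B"
    using assms(3) rainbow_subset by blast+
  have "rk ?X = card A" "rk ?Y = card B"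
    using rank_insert_not_rainbow[of A f y] rank_insert_not_rainbow[of B f y] assms rAB
    by (simp_all add: rainbow_iff_rank)
  moreover have "rk (f ` (A \<union> B)) \<le> rk (?X \<union> ?Y)" by (intro rank_mono) auto
  moreover have "rk (f ` (A \<union> B)) = card (A \<union> B)"
    using assms rainbow_iff_rank by (metis finite_UnI)
  moreover have "rk (f ` insert y (A \<inter> B)) \<le> rk (?X \<inter> ?Y)" by (intro rank_mono) auto
  moreover have "rk (f ` insert y (A \<inter> B)) = Suc (card (A \<inter> B))"
    using r assms rainbow_iff_rank[of "insert y (A \<inter> B)" f] by simp
  \<comment> \<open>Submodularity would give \<open>card (A \<union> B) + card (A \<inter> B) + 1
    \<le> card A + card B\<close>.\<close>
  ultimately show False
    using rank_submodular[of ?X ?Y] card_Un_Int[OF assms(1,2)] by linarith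
qed

end

section \<open>Geometric complexes and stellar subdivision\<close>

text \<open>These are the points of the abstract realization of \<open>K\<close>. Coordinates are
  functions on the whole space with support in \<open>K\<close>, so equality of points is equality
  of functions.\<close>

definition bary :: "'a::euclidean_space set set \<Rightarrow> ('a \<Rightarrow> real) \<Rightarrow> bool" where
  "bary K w \<longleftrightarrow> (\<forall>v. 0 \<le> w v) \<and> {v. w v \<noteq> 0} \<in> K \<and> sum w (\<Union>K) = 1"

definition bary_pt :: "'a::euclidean_space set set \<Rightarrow> ('a \<Rightarrow> real) \<Rightarrow> 'a" where
  "bary_pt K w = (\<Sum>v\<in>\<Union>K. w v *\<^sub>R v)"

text \<open>A complex is given by the vertex sets of its simplices. Injectivity of the map from the
  abstract realization to the space says at once that the simplices are affinely independent and
  that they meet in common faces.\<close>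

definition geometric_complex :: "'a::euclidean_space set set \<Rightarrow> bool" where
  "geometric_complex K \<longleftrightarrow> finite K \<and> (\<forall>A\<in>K. finite A) \<and> (\<forall>A\<in>K. \<forall>B\<subseteq>A. B \<in> K) \<and>
     (\<forall>w w'. bary K w \<longrightarrow> bary K w' \<longrightarrow> bary_pt K w = bary_pt K w' \<longrightarrow> w = w')"

lemma geometric_complexD:
  assumes "geometric_complex K"
  shows "finite K" "A \<in> K \<Longrightarrow> finite A" "A \<in> K \<Longrightarrow> B \<subseteq> A \<Longrightarrow> B \<in> K" "finite (\<Union>K)"
    "bary K w \<Longrightarrow> bary K w' \<Longrightarrow> bary_pt K w = bary_pt K w' \<Longrightarrow> w = w'"
proof -
  show "finite K" "A \<in> K \<Longrightarrow> finite A" "A \<in> K \<Longrightarrow> B \<subseteq> A \<Longrightarrow> B \<in> K" "finite (\<Union>K)"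
    using assms unfolding geometric_complex_def by simp_all
  show "bary K w \<Longrightarrow> bary K w' \<Longrightarrow> bary_pt K w = bary_pt K w' \<Longrightarrow> w = w'"
    using assms unfolding geometric_complex_def by simp
qed

lemma bary_extend:
  assumes "geometric_complex K" "A \<in> K" "\<forall>v\<in>A. 0 \<le> u v" "sum u A = 1"
  defines "w \<equiv> \<lambda>v. if v \<in> A then u v else 0"
  shows "bary K w" "bary_pt K w = (\<Sum>v\<in>A. u v *\<^sub>R v)" "{v. w v \<noteq> 0} \<subseteq> A"
proof -
  note gc = geometric_complexD[OF assms(1)]
  show sub: "{v. w v \<noteq> 0} \<subseteq> A" unfolding w_def by auto
  have "sum w (\<Union>K) = sum u A"
    using assms(2) gc(4) unfolding w_def by (intro sum.mono_neutral_cong_right) auto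
  then show "bary K w"
    unfolding bary_def using assms gc(3)[OF assms(2) sub] by (auto simp: w_def)
  show "bary_pt K w = (\<Sum>v\<in>A. u v *\<^sub>R v)"
    using assms(2) gc(4) unfolding bary_pt_def w_def by (intro sum.mono_neutral_cong_right) auto
qed

lemma bary_of_hull:
  assumes "geometric_complex K" "A \<in> K" "p \<in> convex hull A"
  obtains w where "bary K w" "bary_pt K w = p" "{v. w v \<noteq> 0} \<subseteq> A"
proof -
  obtain u where u: "\<forall>v\<in>A. 0 \<le> u v" "sum u A = 1" "(\<Sum>v\<in>A. u v *\<^sub>R v) = p"
    using assms(3) convex_hull_finite[OF geometric_complexD(2)[OF assms(1,2)]] by auto
  note b = bary_extend[OF assms(1,2) u(1,2)]
  show thesis by (rule that[OF b(1) _ b(3)]) (simp only: b(2) u(3))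
qed

lemma bary_pt_in_hull:
  assumes "geometric_complex K" "bary K w" "{v. w v \<noteq> 0} \<subseteq> A" "A \<in> K"
  shows "bary_pt K w \<in> convex hull A"
proof -
  note gc = geometric_complexD[OF assms(1)]
  have "sum w A = sum w (\<Union>K)" "(\<Sum>v\<in>A. w v *\<^sub>R v) = bary_pt K w"
    unfolding bary_pt_def using assms gc(4) by (auto intro!: sum.mono_neutral_left)
  then show ?thesis
    using assms(2) gc(2)[OF assms(4)] by (auto simp: convex_hull_finite bary_def)
qed

text \<open>An affine dependence on \<open>A\<close> can be added, suitably scaled, to the uniform
  weights on \<open>A\<close>. This gives two different coordinate functions of the same
  point.\<close>

lemma geometric_complex_affine_independent:
  assumes "geometric_complex K" "A \<in> K"
  shows "\<not> affine_dependent A"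
proof
  assume "affine_dependent A"
  note gc = geometric_complexD[OF assms(1)]
  have fin: "finite A" using gc(2) assms(2) .
  obtain u where u: "sum u A = 0" "\<exists>v\<in>A. u v \<noteq> 0" "(\<Sum>v\<in>A. u v *\<^sub>R v) = 0"
    using \<open>affine_dependent A\<close> affine_dependent_explicit_finite[OF fin] by blast
  define n where "n = real (card A)"
  \<comment> \<open>\<open>M\<close> bounds every \<open>\<bar>u v\<bar>\<close>, so the perturbed
    weights \<open>b\<close> stay nonnegative; the summand 1 makes it positive at once.\<close>
  define M where "M = 1 + (\<Sum>v\<in>A. \<bar>u v\<bar>)"
  have n: "n > 0" using u(2) fin unfolding n_def by (auto simp: card_gt_0_iff)
  have M: "M > 0" unfolding M_def by (simp add: add_pos_nonneg sum_nonneg)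
  have uM: "\<bar>u v\<bar> \<le> M" if "v \<in> A" for v
    using member_le_sum[of v A "\<lambda>v. \<bar>u v\<bar>"] that fin unfolding M_def by simp
  define a where "a = (\<lambda>v::'a. 1 / n)"
  define b where "b = (\<lambda>v. 1 / n + u v / (n * M))"
  have nonneg: "\<forall>v\<in>A. 0 \<le> a v" "\<forall>v\<in>A. 0 \<le> b v"
  proof -
    show "\<forall>v\<in>A. 0 \<le> a v" using n unfolding a_def by simp
    show "\<forall>v\<in>A. 0 \<le> b v"
    proof
      fix v assume "v \<in> A"
      then have "0 \<le> (M + u v) / (n * M)" using uM n M by (intro divide_nonneg_pos) force+
      also have "\<dots> = b v" using n M unfolding b_def by (simp add: field_simps)
      finally show "0 \<le> b v" .
    qed
  qed
  have sa: "sum a A = 1" using n unfolding a_def n_def by simp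
  have sb: "sum b A = 1"
    using sa u(1) unfolding a_def b_def by (simp add: sum.distrib flip: sum_divide_distrib)
  have "(\<Sum>v\<in>A. b v *\<^sub>R v) = (\<Sum>v\<in>A. a v *\<^sub>R v) + (1 / (n * M)) *\<^sub>R (\<Sum>v\<in>A. u v *\<^sub>R v)"
    unfolding a_def b_def by (simp add: scaleR_add_left sum.distrib scaleR_right.sum)
  then have pt: "(\<Sum>v\<in>A. b v *\<^sub>R v) = (\<Sum>v\<in>A. a v *\<^sub>R v)" using u(3) by simp
  have "(\<lambda>v. if v \<in> A then a v else 0) = (\<lambda>v. if v \<in> A then b v else 0)"
    by (rule gc(5)) (simp_all only: bary_extend[OF assms nonneg(1) sa]
        bary_extend[OF assms nonneg(2) sb] pt)
  then have "\<forall>v\<in>A. a v = b v" by metis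
  then show False using u(2) n M unfolding a_def b_def by auto
qed

text \<open>A point of both hulls has coordinates supported in \<open>A\<close> and coordinates
  supported in \<open>B\<close>; by uniqueness they coincide, so their support lies in
  \<open>A \<inter> B\<close>.\<close>

lemma geometric_complex_hull_Int:
  assumes "geometric_complex K" "A \<in> K" "B \<in> K"
  shows "convex hull A \<inter> convex hull B = convex hull (A \<inter> B)"
proof
  show "convex hull A \<inter> convex hull B \<subseteq> convex hull (A \<inter> B)"
  proof
    fix p assume p: "p \<in> convex hull A \<inter> convex hull B"
    obtain w where w: "bary K w" "bary_pt K w = p" "{v. w v \<noteq> 0} \<subseteq> A"
      using bary_of_hull[OF assms(1,2)] p by blast
    obtain w' where w': "bary K w'" "bary_pt K w' = p" "{v. w' v \<noteq> 0} \<subseteq> B"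
      using bary_of_hull[OF assms(1,3)] p by blast
    have "w = w'" using geometric_complexD(5)[OF assms(1)] w w' by simp
    moreover have "A \<inter> B \<in> K" using geometric_complexD(3)[OF assms(1,2)] by simp
    ultimately show "p \<in> convex hull (A \<inter> B)"
      using bary_pt_in_hull[OF assms(1) w(1), of "A \<inter> B"] w w' by blast
  qed
qed (simp add: hull_mono)

section \<open>Passage between geometric complexes and triangulations\<close>

lemma simplex_vertices_hull:
  "\<not> affine_dependent A \<Longrightarrow> simplex_vertices (convex hull A) = A"
  unfolding simplex_vertices_def by (simp add: extreme_point_of_convex_hull_affine_independent)

lemma simplicial_complex_hulls:
  assumes "geometric_complex K"
  shows "simplicial_complex ((hull) convex ` K)"
  unfolding simplicial_complex_def
proof (intro conjI allI impI ballI)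
  note gc = geometric_complexD[OF assms]
  note ai = geometric_complex_affine_independent[OF assms]
  show "finite ((hull) convex ` K)" using gc(1) by simp
  show "\<exists>n. n simplex S" if S: "S \<in> (hull) convex ` K" for S
  proof -
    obtain A where A: "A \<in> K" "S = convex hull A" using S by blast
    then have "(int (card A) - 1) simplex S" unfolding simplex_def using ai by auto
    then show ?thesis by blast
  qed
  show "F \<in> (hull) convex ` K" if SF: "S \<in> (hull) convex ` K \<and> F face_of S" for F S
  proof -
    obtain A where A: "A \<in> K" "S = convex hull A" using SF by blast
    obtain B where "B \<subseteq> A" "F = convex hull B"
      using face_of_convex_hull_affine_independent[OF ai[OF A(1)], of F] SF A(2) by auto
    then show ?thesis using gc(3)[OF A(1)] by blast
  qed
  show "(S \<inter> S') face_of S" if SS: "S \<in> (hull) convex ` K \<and> S' \<in> (hull) convex ` K" for S S'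
  proof -
    obtain A B where A: "A \<in> K" "S = convex hull A" and B: "B \<in> K" "S' = convex hull B"
      using SS by blast
    then show ?thesis
      using geometric_complex_hull_Int[OF assms A(1) B(1)] ai[OF A(1)]
      by (metis face_of_convex_hull_affine_independent inf_le1)
  qed
qed

text \<open>Injectivity: a point lies in the relative interior of the hull of the support of its
  coordinates. The intersection of two such hulls is a face of each; containing a relative interior
  point of each, it equals both. So the supports agree, and affine independence makes the
  coordinates agree.\<close>

lemma geometric_complex_of_simplicial_complex:
  fixes T :: "'a::euclidean_space set set"
  assumes "simplicial_complex T"
  shows "geometric_complex (simplex_vertices ` T)" "(hull) convex ` simplex_vertices ` T = T"
proof -
  let ?K = "simplex_vertices ` T"
  have fin: "finite T"
    and spx: "\<And>S. S \<in> T \<Longrightarrow> \<exists>n. n simplex S"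
    and face: "\<And>F S. S \<in> T \<Longrightarrow> F face_of S \<Longrightarrow> F \<in> T"
    and int: "\<And>S S'. S \<in> T \<Longrightarrow> S' \<in> T \<Longrightarrow> (S \<inter> S') face_of S"
    using assms unfolding simplicial_complex_def by blast+
  have verts: "\<not> affine_dependent (simplex_vertices S) \<and> convex hull (simplex_vertices S) = S"
    if "S \<in> T" for S
    using spx[OF that] simplex_vertices_hull unfolding simplex_def by metis
  show "(hull) convex ` ?K = T" using verts by force
  have K: "A \<in> ?K \<longleftrightarrow> \<not> affine_dependent A \<and> convex hull A \<in> T" for A
    using verts simplex_vertices_hull by (metis image_iff)
  have finA: "finite A" if "A \<in> ?K" for A
    using that K aff_independent_finite by blast
  have finU: "finite (\<Union>?K)" using fin finA by auto
  show "geometric_complex ?K"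
    unfolding geometric_complex_def
  proof (intro conjI ballI allI impI)
    show "finite ?K" using fin by simp
    show "finite A" if "A \<in> ?K" for A using finA that .
    show "B \<in> ?K" if "A \<in> ?K" "B \<subseteq> A" for A B
    proof -
      have "\<not> affine_dependent A" "convex hull A \<in> T" using K that by auto
      then have "convex hull B face_of convex hull A" "\<not> affine_dependent B"
        using face_of_convex_hull_affine_independent that(2) affine_independent_subset by blast+
      then show ?thesis using K face \<open>convex hull A \<in> T\<close> by blast
    qed
    fix w w' assume w: "bary ?K w" and w': "bary ?K w'" and eq: "bary_pt ?K w = bary_pt ?K w'"
    let ?A = "{v. w v \<noteq> 0}" and ?B = "{v. w' v \<noteq> 0}"
    have supp: "sum u {v. u v \<noteq> 0} = 1 \<and> (\<Sum>v | u v \<noteq> 0. u v *\<^sub>R v) = bary_pt ?K u"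
      if "bary ?K u" for u
    proof -
      have "{v. u v \<noteq> 0} \<subseteq> \<Union>?K" using that unfolding bary_def by blast
      then have "sum u {v. u v \<noteq> 0} = sum u (\<Union>?K)"
        "(\<Sum>v | u v \<noteq> 0. u v *\<^sub>R v) = (\<Sum>v\<in>\<Union>?K. u v *\<^sub>R v)"
        using finU by (auto intro!: sum.mono_neutral_left)
      then show ?thesis using that unfolding bary_def bary_pt_def by simp
    qed
    have ri: "bary_pt ?K u \<in> rel_interior (convex hull {v. u v \<noteq> 0})" if "bary ?K u" for u
    proof -
      have "\<not> affine_dependent {v. u v \<noteq> 0}" using that K unfolding bary_def by blast
      moreover have "\<forall>v\<in>{v. u v \<noteq> 0}. 0 < u v"
        using that unfolding bary_def by (simp add: less_le)
      ultimately show ?thesis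
        using supp[OF that] by (subst rel_interior_convex_hull_explicit) blast+
    qed
    have AB: "?A \<in> ?K" "?B \<in> ?K" using w w' unfolding bary_def by auto
    let ?I = "convex hull ?A \<inter> convex hull ?B"
    have pI: "bary_pt ?K w \<in> ?I"
      using ri[OF w] ri[OF w'] eq rel_interior_subset by fastforce
    have "?I face_of convex hull ?A" "?I face_of convex hull ?B"
      using int AB K by (simp, metis inf_commute)
    then have "?I = convex hull ?A" "?I = convex hull ?B"
      using face_of_disjoint_rel_interior pI ri[OF w] ri[OF w'] eq by (metis IntI empty_iff)+
    then have "convex hull ?A = convex hull ?B" by simp
    then have same: "?A = ?B" using AB K simplex_vertices_hull by metis
    have dep: "\<not> affine_dependent ?A" using AB K by blast
    have finA': "finite ?A" using finA AB by blast
    have "sum (\<lambda>v. w v - w' v) ?A = 0"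
      using supp[OF w] supp[OF w'] same by (simp add: sum_subtractf)
    moreover have "(\<Sum>v\<in>?A. (w v - w' v) *\<^sub>R v) = 0"
      using supp[OF w] supp[OF w'] same eq by (simp add: sum_subtractf scaleR_diff_left)
    ultimately have "\<forall>v\<in>?A. w v - w' v = 0"
      using dep[unfolded affine_dependent_explicit_finite[OF finA'], simplified not_ex,
          rule_format, of "\<lambda>v. w v - w' v"] by blast
    then show "w = w'" using same by fastforce
  qed
qed

section \<open>Stellar subdivision\<close>

text \<open>Stellar subdivision at \<open>S\<close>: the simplices through \<open>S\<close> are
  removed, and \<open>z\<close> is coned over those faces of the closed star of \<open>S\<close>
  that do not contain \<open>S\<close>. The case \<open>A = {}\<close> contributes the vertex
  \<open>z\<close> itself.\<close>

definition star :: "'a set set \<Rightarrow> 'a set \<Rightarrow> 'a \<Rightarrow> 'a set set" where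
  "star K S z = {A \<in> K. \<not> S \<subseteq> A} \<union> {insert z A | A. A \<union> S \<in> K \<and> \<not> S \<subseteq> A}"

lemma star_insertI: "A \<union> S \<in> K \<Longrightarrow> \<not> S \<subseteq> A \<Longrightarrow> insert z A \<in> star K S z"
  unfolding star_def by blast

definition barycenter :: "'a::real_vector set \<Rightarrow> 'a" where
  "barycenter S = (\<Sum>v\<in>S. (1 / real (card S)) *\<^sub>R v)"

lemma barycenter_in_hull:
  assumes "finite S" "S \<noteq> {}"
  shows "barycenter S \<in> convex hull S"
proof -
  have "sum (\<lambda>v. 1 / real (card S)) S = 1" using assms by simp
  then show ?thesis
    unfolding convex_hull_finite[OF assms(1)] barycenter_def
    by (intro CollectI exI[of _ "\<lambda>v. 1 / real (card S)"]) auto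
qed

text \<open>If the barycenter were a vertex, the uniform weights on \<open>S\<close> and the unit
  mass at that vertex would be two coordinate functions of one point.\<close>

lemma barycenter_fresh:
  assumes "geometric_complex K" "S \<in> K" "card S \<ge> 2"
  shows "barycenter S \<notin> \<Union>K"
proof
  let ?z = "barycenter S" and ?s = "\<lambda>v. 1 / real (card S)"
  assume "?z \<in> \<Union>K"
  then have zK: "{?z} \<in> K" using geometric_complexD(3)[OF assms(1)] by blast
  have "sum ?s S = 1" using assms(3) by auto
  note s = bary_extend[OF assms(1,2) _ this]
  note d = bary_extend[OF assms(1) zK, of "\<lambda>_. 1"]
  have "(\<lambda>v. if v \<in> S then ?s v else 0) = (\<lambda>v. if v \<in> {?z} then 1 else 0)"
    by (rule geometric_complexD(5)[OF assms(1)]) (use s d in \<open>auto simp: barycenter_def\<close>)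
  then have "(if v \<in> S then ?s v else 0) = (if v \<in> {?z} then 1 else 0)" for v
    by meson
  then have "S \<subseteq> {?z}" using assms(3) by (metis divide_eq_0_iff of_nat_eq_0_iff not_numeral_le_zero subsetI zero_neq_one)
  then have "card S \<le> 1" using card_mono[of "{?z}" S] by simp
  then show False using assms(3) by simp
qed

text \<open>No vertex gets lost, because a set \<open>S\<close> with at least two elements is
  contained in no singleton.\<close>

lemma Union_star:
  assumes "\<And>A B. A \<in> K \<Longrightarrow> B \<subseteq> A \<Longrightarrow> B \<in> K" "S \<in> K" "card S \<ge> 2"
  shows "\<Union>(star K S z) = insert z (\<Union>K)"
proof
  show "\<Union>(star K S z) \<subseteq> insert z (\<Union>K)" 
    unfolding star_def by (simp only: Sup_subset_mono Union_Un_distrib) fast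
  have "S \<noteq> {}" using assms(3) by auto
  then have "{} \<union> S \<in> K \<and> \<not> S \<subseteq> {}" using assms(2) by simp
  then have "{z} \<in> star K S z" unfolding star_def by blast
  moreover have "{v} \<in> star K S z" if "v \<in> \<Union>K" for v
  proof -
    have "\<not> S \<subseteq> {v}" using assms(3) card_mono[of "{v}" S] by auto
    then show ?thesis unfolding star_def using assms(1) that by blast
  qed
  ultimately show "insert z (\<Union>K) \<subseteq> \<Union>(star K S z)" by blast
qed

text \<open>Translates coordinates after the subdivision into coordinates before it: the weight of
  \<open>z\<close> is distributed evenly over \<open>S\<close>.\<close>

definition unstar :: "'a set \<Rightarrow> 'a \<Rightarrow> ('a \<Rightarrow> real) \<Rightarrow> 'a \<Rightarrow> real" where
  "unstar S z w v = (if v = z then 0 else w v) + (if v \<in> S then w z / real (card S) else 0)"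

text \<open>\<open>unstar\<close> preserves the represented point, so uniqueness in \<open>K\<close>
  reduces the claim to injectivity of \<open>unstar\<close>. No simplex of the star contains
  \<open>S\<close>, so some vertex of \<open>S\<close> always has weight 0, and the weight of
  \<open>z\<close> can be read off there.\<close>

lemma geometric_complex_star:
  assumes gc: "geometric_complex K" and S: "S \<in> K" "card S \<ge> 2"
  defines "z \<equiv> barycenter S"
  shows "geometric_complex (star K S z)"
proof -
  note g = geometric_complexD[OF gc]
  let ?n = "real (card S)"
  have n: "?n > 0" using S(2) by simp
  have zK: "z \<notin> \<Union>K" using barycenter_fresh[OF gc S] unfolding z_def .
  have zS: "z \<notin> S" using zK S(1) by blast
  have U: "\<Union>(star K S z) = insert z (\<Union>K)" using Union_star[OF g(3) S] .
  have SU: "S \<subseteq> \<Union>K" using S(1) by blast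
  have missing: "\<exists>v\<in>S. w v = 0" if "bary (star K S z) w" for w
  proof -
    have "\<not> S \<subseteq> {v. w v \<noteq> 0}" using that zS unfolding bary_def star_def by auto
    then show ?thesis by blast
  qed
  have unstar: "bary K (unstar S z w) \<and> bary_pt K (unstar S z w) = bary_pt (star K S z) w"
    if w: "bary (star K S z) w" for w
  proof -
    have nn: "0 \<le> w v" for v using w unfolding bary_def by blast
    \<comment> \<open>Weights are nonnegative, so no cancellation occurs and the support is the
      expected union.\<close>
    have nz: "unstar S z w v \<noteq> 0 \<longleftrightarrow> (v \<noteq> z \<and> w v \<noteq> 0) \<or> (v \<in> S \<and> w z \<noteq> 0)" for v
      using n nn[of v] nn[of z] unfolding unstar_def by (auto simp: add_nonneg_eq_0_iff)
    have supp: "{v. unstar S z w v \<noteq> 0} \<in> K"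
    proof (cases "w z = 0")
      case True
      then have "{v. unstar S z w v \<noteq> 0} = {v. w v \<noteq> 0}" using nz by auto
      moreover have "z \<notin> {v. w v \<noteq> 0}" using True by simp
      ultimately show ?thesis using w unfolding bary_def star_def by auto
    next
      case False
      then have "{v. w v \<noteq> 0} \<notin> K" using zK by blast
      then obtain A where A: "{v. w v \<noteq> 0} = insert z A" "A \<union> S \<in> K"
        using w unfolding bary_def star_def by auto
      have "z \<notin> A" using A(2) zK by blast
      then have "{v. unstar S z w v \<noteq> 0} = A \<union> S" using nz False A(1) zS by auto
      then show ?thesis using A(2) by simp
    qed
    have sumS: "(\<Sum>v\<in>\<Union>K. if v \<in> S then c v else 0) = sum c S" for c :: "'a \<Rightarrow> 'b::comm_monoid_add"
      using SU g(4) by (simp add: sum.If_cases Int_absorb1)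
    have sumz: "(\<Sum>v\<in>\<Union>K. if v = z then 0 else c v) = sum c (\<Union>K)" for c :: "'a \<Rightarrow> 'b::comm_monoid_add"
      using zK by (intro sum.cong) auto
    have "sum (unstar S z w) (\<Union>K) = sum w (\<Union>K) + w z"
      using n unfolding unstar_def by (simp add: sum.distrib sumS sumz)
    also have "\<dots> = 1" using w zK g(4) unfolding bary_def U by simp
    finally have 1: "sum (unstar S z w) (\<Union>K) = 1" .
    have "bary_pt K (unstar S z w) = (\<Sum>v\<in>\<Union>K. (if v = z then 0 else w v *\<^sub>R v)
         + (if v \<in> S then (w z / ?n) *\<^sub>R v else 0))"
      unfolding bary_pt_def unstar_def by (intro sum.cong) (auto simp: scaleR_add_left)
    also have "\<dots> = (\<Sum>v\<in>\<Union>K. w v *\<^sub>R v) + w z *\<^sub>R z"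
      unfolding z_def[unfolded barycenter_def] sum.distrib sumS
      using sumz by (simp add: scaleR_right.sum z_def barycenter_def)
    also have "\<dots> = bary_pt (star K S z) w"
      using zK g(4) unfolding bary_pt_def U by simp
    finally show ?thesis
      using supp 1 nn n unfolding bary_def by (auto simp: unstar_def)
  qed
  show ?thesis
    unfolding geometric_complex_def
  proof (intro conjI ballI allI impI)
    have "star K S z \<subseteq> Pow (insert z (\<Union>K))" using U by blast
    then show "finite (star K S z)" using g(4) finite_subset by fastforce
    show "finite A" if "A \<in> star K S z" for A
      using that g(4) U by (metis Union_upper finite_insert finite_subset)
    show "B \<in> star K S z" if A: "A \<in> star K S z" and B: "B \<subseteq> A" for A B
    proof (cases "A \<in> K \<and> \<not> S \<subseteq> A")
      case True
      then show ?thesis using g(3) B unfolding star_def by blast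
    next
      case False
      then obtain A' where A': "A = insert z A'" "A' \<union> S \<in> K" "\<not> S \<subseteq> A'"
        using A unfolding star_def by blast
      let ?B = "B - {z}"
      have "?B \<union> S \<subseteq> A' \<union> S" using B A'(1) by blast
      then have *: "?B \<union> S \<in> K" "?B \<in> K" "\<not> S \<subseteq> ?B"
        using g(3)[OF A'(2)] A' B by blast+
      show ?thesis
      proof (cases "z \<in> B")
        case True
        then have "B = insert z ?B" by blast
        then show ?thesis unfolding star_def using * by blast
      next
        case False
        then show ?thesis unfolding star_def using * by simp
      qed
    qed
    fix w w' assume w: "bary (star K S z) w" and w': "bary (star K S z) w'"
      and eq: "bary_pt (star K S z) w = bary_pt (star K S z) w'"
    have e: "unstar S z w = unstar S z w'"
      using g(5) unstar[OF w] unstar[OF w'] eq by metis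
    \<comment> \<open>At a vertex of \<open>S\<close> where \<open>b\<close> vanishes,
      \<open>unstar\<close> sees only the share coming from \<open>b z\<close>, which must cover the
      share coming from \<open>a z\<close>. Exchanging the roles gives equality.\<close>
    have le: "a z \<le> b z" if "bary (star K S z) a" "bary (star K S z) b"
        "unstar S z a = unstar S z b" for a b
    proof -
      obtain v where v: "v \<in> S" "b v = 0" using missing \<open>bary _ b\<close> by blast
      then have "v \<noteq> z" using zS by blast
      then have "a v + a z / ?n = b z / ?n"
        using fun_cong[OF that(3), of v] v unfolding unstar_def by simp
      moreover have "0 \<le> a v" using that(1) unfolding bary_def by blast
      ultimately have "a z / ?n \<le> b z / ?n" by linarith
      then show ?thesis using n by (simp add: divide_le_cancel)
    qed
    have "w z = w' z" using le[OF w w' e] le[OF w' w e[symmetric]] by simp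
    moreover have "w v = w' v" if "v \<noteq> z" for v
      using fun_cong[OF e, of v] that \<open>w z = w' z\<close> unfolding unstar_def by (simp split: if_splits)
    ultimately show "w = w'" by (metis ext)
  qed
qed

section \<open>Refinement of complexes\<close>

text \<open>The second condition is the pointwise form of the requirement that every old simplex is
  a union of new ones; in this form it composes directly.\<close>

definition complex_refines :: "'a::euclidean_space set set \<Rightarrow> 'a set set \<Rightarrow> bool" where
  "complex_refines K' K \<longleftrightarrow> (\<forall>B\<in>K'. \<exists>A\<in>K. convex hull B \<subseteq> convex hull A) \<and>
     (\<forall>A\<in>K. \<forall>p\<in>convex hull A. \<exists>B\<in>K'. p \<in> convex hull B \<and> convex hull B \<subseteq> convex hull A)"

lemma complex_refinesI:
  assumes "\<And>B. B \<in> K' \<Longrightarrow> \<exists>A\<in>K. convex hull B \<subseteq> convex hull A"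
    and "\<And>A p. A \<in> K \<Longrightarrow> p \<in> convex hull A \<Longrightarrow>
      \<exists>B\<in>K'. p \<in> convex hull B \<and> convex hull B \<subseteq> convex hull A"
  shows "complex_refines K' K"
  unfolding complex_refines_def using assms by simp

lemma complex_refinesE1:
  assumes "complex_refines K' K" "B \<in> K'"
  obtains A where "A \<in> K" "convex hull B \<subseteq> convex hull A"
  using assms unfolding complex_refines_def by (elim conjE) (drule (1) bspec, erule bexE)

lemma complex_refinesE2:
  assumes "complex_refines K' K" "A \<in> K" "p \<in> convex hull A"
  obtains B where "B \<in> K'" "p \<in> convex hull B" "convex hull B \<subseteq> convex hull A"
proof -
  have "\<exists>B\<in>K'. p \<in> convex hull B \<and> convex hull B \<subseteq> convex hull A"
    using assms unfolding complex_refines_def by simp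
  then show thesis using that by (elim bexE conjE)
qed

lemma complex_refines_refl: "complex_refines K K"
  by (rule complex_refinesI) (rule bexI, rule subset_refl, assumption, rule bexI, simp_all)

lemma complex_refines_trans:
  assumes 1: "complex_refines K'' K'" and 2: "complex_refines K' K"
  shows "complex_refines K'' K"
proof (rule complex_refinesI)
  fix C assume "C \<in> K''"
  obtain B where B: "B \<in> K'" "convex hull C \<subseteq> convex hull B"
    by (rule complex_refinesE1[OF 1 \<open>C \<in> K''\<close>])
  obtain A where "A \<in> K" "convex hull B \<subseteq> convex hull A"
    by (rule complex_refinesE1[OF 2 B(1)])
  then show "\<exists>A\<in>K. convex hull C \<subseteq> convex hull A"
    using B(2) by (meson subset_trans)
next
  fix A p assume A: "A \<in> K" "p \<in> convex hull A"
  obtain B where B: "B \<in> K'" "p \<in> convex hull B" "convex hull B \<subseteq> convex hull A"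
    by (rule complex_refinesE2[OF 2 A])
  obtain C where "C \<in> K''" "p \<in> convex hull C" "convex hull C \<subseteq> convex hull B"
    by (rule complex_refinesE2[OF 1 B(1,2)])
  then show "\<exists>C\<in>K''. p \<in> convex hull C \<and> convex hull C \<subseteq> convex hull A"
    using B(3) by (meson subset_trans)
qed

text \<open>For a point of a simplex \<open>A\<close> through \<open>S\<close>, subtract the least
  coordinate on \<open>S\<close> from all coordinates on \<open>S\<close> and give the removed
  weight to \<open>z\<close>. A vertex \<open>v0\<close> attaining the minimum drops out, which
  leaves a simplex of the star.\<close>

lemma star_refines:
  assumes gc: "geometric_complex K" and S: "S \<in> K" "card S \<ge> 2"
  shows "complex_refines (star K S (barycenter S)) K"
proof -
  note g = geometric_complexD[OF gc]
  let ?z = "barycenter S" and ?n = "real (card S)"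
  have n: "?n > 0" using S(2) by simp
  have finS: "finite S" "S \<noteq> {}" using g(2) S by auto
  have zS: "?z \<in> convex hull S" using barycenter_in_hull finS .
  have ins: "convex hull (insert ?z A) \<subseteq> convex hull (A \<union> S)" for A
  proof (rule hull_minimal)
    have "?z \<in> convex hull (A \<union> S)" using zS hull_mono[of S "A \<union> S"] by blast
    then show "insert ?z A \<subseteq> convex hull (A \<union> S)" using hull_subset[of "A \<union> S"] by blast
  qed simp
  have "\<exists>B\<in>star K S ?z. p \<in> convex hull B \<and> convex hull B \<subseteq> convex hull A"
    if A: "A \<in> K" and p: "p \<in> convex hull A" for A p
  proof (cases "S \<subseteq> A")
    case False
    then have "A \<in> star K S ?z" using A unfolding star_def by simp
    then show ?thesis using p by (intro bexI[of _ A]) simp_all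
  next
    case True
    have finA: "finite A" using g(2) A .
    obtain u where u: "\<forall>v\<in>A. 0 \<le> u v" "sum u A = 1" "(\<Sum>v\<in>A. u v *\<^sub>R v) = p"
      using p unfolding convex_hull_finite[OF finA] by blast
    define m where "m = Min (u ` S)"
    have "m \<in> u ` S" unfolding m_def using finS by (intro Min_in) auto
    then obtain v0 where v0: "v0 \<in> S" "u v0 = m" by blast
    have mle: "m \<le> u v" if "v \<in> S" for v unfolding m_def using finS that by auto
    have m0: "0 \<le> m" using v0 u(1) True by blast
    let ?B = "insert ?z (A - {v0})"
    have AS: "(A - {v0}) \<union> S = A" using True v0 by blast
    have B: "?B \<in> star K S ?z" using AS A v0(1) by (intro star_insertI) auto
    \<comment> \<open>The removed weight is \<open>?n * m\<close> in total, and it represents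
      \<open>(?n * m) *\<^sub>R ?z\<close> because \<open>z\<close> is the barycenter.\<close>
    let ?c = "\<lambda>v. u v - (if v \<in> S then m else 0)"
    have c0: "?c v0 = 0" using v0 by simp
    have sumS: "(\<Sum>v\<in>A. if v \<in> S then c v else 0) = sum c S" for c :: "'a \<Rightarrow> 'b::comm_monoid_add"
      using True finA by (simp add: sum.If_cases Int_absorb1)
    have "sum ?c A = 1 - ?n * m" using u(2) by (simp add: sum_subtractf sumS)
    then have c1: "sum ?c (A - {v0}) = 1 - ?n * m"
      using c0 finA by (simp add: sum_diff1)
    have nm: "?n *\<^sub>R ?z = (\<Sum>v\<in>S. v)" using n unfolding barycenter_def by (simp add: scaleR_right.sum)
    have "(\<Sum>v\<in>A. ?c v *\<^sub>R v) = (\<Sum>v\<in>A. u v *\<^sub>R v - (if v \<in> S then m *\<^sub>R v else 0))"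
      by (intro sum.cong) (auto simp: scaleR_diff_left)
    also have "\<dots> = p - m *\<^sub>R (\<Sum>v\<in>S. v)"
      using u(3) by (simp add: sum_subtractf sumS scaleR_right.sum)
    also have "\<dots> = p - (?n * m) *\<^sub>R ?z" using nm by (metis mult.commute scaleR_scaleR)
    finally have c2: "(\<Sum>v\<in>A - {v0}. ?c v *\<^sub>R v) = p - (?n * m) *\<^sub>R ?z"
      using c0 finA by (simp add: sum_diff1)
    have "(?n * m) *\<^sub>R ?z + (\<Sum>v\<in>A - {v0}. ?c v *\<^sub>R v) \<in> convex hull ?B"
    proof -
      have zA: "?z \<notin> A" using barycenter_fresh[OF gc S] A by blast
      let ?d = "\<lambda>v. if v = ?z then ?n * m else ?c v"
      have nn: "\<forall>v\<in>?B. 0 \<le> ?d v" using mle u(1) m0 n by auto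
      have "?d v = ?c v" if "v \<in> A - {v0}" for v using that zA by auto
      then have d: "sum ?d (A - {v0}) = sum ?c (A - {v0})"
        "(\<Sum>v\<in>A - {v0}. ?d v *\<^sub>R v) = (\<Sum>v\<in>A - {v0}. ?c v *\<^sub>R v)"
        by (simp_all only: cong: sum.cong)
      have "sum ?d ?B = 1" using zA finA d(1) c1 by simp
      moreover have "(\<Sum>v\<in>?B. ?d v *\<^sub>R v) = (?n * m) *\<^sub>R ?z + (\<Sum>v\<in>A - {v0}. ?c v *\<^sub>R v)"
        using zA finA d(2) by simp
      moreover have "finite ?B" using finA by simp
      ultimately show ?thesis
        unfolding convex_hull_finite[OF \<open>finite ?B\<close>]
        by (intro CollectI exI[of _ ?d] conjI nn) (simp_all only:)
    qed
    then have "p \<in> convex hull ?B" using c2 by simp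
    moreover have "convex hull ?B \<subseteq> convex hull A" using ins[of "A - {v0}"] AS by simp
    ultimately show ?thesis using B by (intro bexI[of _ ?B]) simp_all
  qed
  moreover have "\<exists>A\<in>K. convex hull B \<subseteq> convex hull A" if B: "B \<in> star K S ?z" for B
  proof (cases "B \<in> K")
    case True
    then show ?thesis by (intro bexI[of _ B]) simp_all
  next
    case False
    then obtain A where "B = insert ?z A" "A \<union> S \<in> K" using B unfolding star_def by auto
    then show ?thesis using ins[of A] by (intro bexI[of _ "A \<union> S"]) simp_all
  qed
  ultimately show ?thesis by (intro complex_refinesI)
qed

section \<open>Rainbow refinement\<close>

context matroid
begin

text \<open>\<open>U\<close> is the set of vertices that already carry their final label. A vertex \<open>u\<close> outside \<open>U\<close> will
  get a label outside the span of \<open>F u\<close>; the inequality guarantees that such a label exists, also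
  for the vertices that are created later.\<close>

definition budget :: "nat \<Rightarrow> 'v set set \<Rightarrow> ('v \<Rightarrow> 'w) \<Rightarrow> 'v set \<Rightarrow> ('v \<Rightarrow> 'w set) \<Rightarrow> bool" where
  "budget k K f U F \<longleftrightarrow> (\<forall>B\<in>K. \<forall>u\<in>B - U. rk (F u \<union> f ` (B \<inter> U)) + card (B - U) \<le> k)"

lemma budgetD:
  "budget k K f U F \<Longrightarrow> B \<in> K \<Longrightarrow> u \<in> B \<Longrightarrow> u \<notin> U \<Longrightarrow> rk (F u \<union> f ` (B \<inter> U)) + card (B - U) \<le> k"
  unfolding budget_def by blast

lemma star_cases:
  assumes "B \<in> star K S z"
  obtains (old) "B \<in> K" "\<not> S \<subseteq> B" | (new) C where "B = insert z C" "C \<union> S \<in> K" "\<not> S \<subseteq> C"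
  using assms unfolding star_def by auto

text \<open>Starring creates no new bad set. A bad \<open>C \<inter> U\<close> must contain
  \<open>y\<close>, and so does \<open>S\<close>; by uniqueness of the circuit through
  \<open>y\<close>, their common part is bad too. As \<open>C\<close> does not contain
  \<open>S\<close>, this part is a proper subset of \<open>S\<close>, against minimality.\<close>

lemma rainbow_star_new:
  assumes down: "\<And>A B. A \<in> K \<Longrightarrow> B \<subseteq> A \<Longrightarrow> B \<in> K" and fin: "\<And>A. A \<in> K \<Longrightarrow> finite A"
    and a: "\<And>B. B \<in> K \<Longrightarrow> B \<subseteq> U - {y} \<Longrightarrow> rainbow f B"
    and S: "S \<subseteq> U" "y \<in> S" "\<not> rainbow f S"
    and min: "\<And>B. B \<in> K \<Longrightarrow> B \<subset> S \<Longrightarrow> rainbow f B"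
    and C: "C \<union> S \<in> K" "\<not> S \<subseteq> C"
  shows "rainbow f (C \<inter> U)"
proof (rule ccontr)
  assume bad: "\<not> rainbow f (C \<inter> U)"
  have CU: "C \<inter> U \<in> K" by (rule down[OF C(1)]) auto
  have y: "y \<in> C \<inter> U" using a[OF CU] bad by auto
  let ?A = "S - {y}" and ?B = "C \<inter> U - {y}"
  have SK: "S \<in> K" by (rule down[OF C(1)]) auto
  have AB: "insert y ?A = S" "insert y ?B = C \<inter> U" using y S(2) by auto
  have "?A \<union> ?B \<in> K" by (rule down[OF C(1)]) auto
  then have "rainbow f (?A \<union> ?B)" by (rule a) (use S(1) in auto)
  then have "\<not> rainbow f (insert y (?A \<inter> ?B))"
    using bad S(3) AB fin[OF SK] fin[OF CU] by (intro not_rainbow_insert_Int) auto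
  moreover have "insert y (?A \<inter> ?B) \<subset> S" using S(1,2) C(2) y by auto
  moreover have "insert y (?A \<inter> ?B) \<in> K" by (rule down[OF SK]) (use S(2) in auto)
  ultimately show False using min by metis
qed

text \<open>Repairs all bad simplices caused by the label just given to \<open>y\<close>, by
  induction on their number. The sixth assumption is a sharper budget that still counts
  \<open>y\<close> as unlabelled. It is demanded only where the labelled part is not rainbow, and
  this restriction is what makes it survive starring.\<close>

lemma rainbow_around_vertex:
  fixes K :: "'a::euclidean_space set set"
  assumes "geometric_complex K" "U \<subseteq> \<Union>K" "y \<in> U"
    and "\<And>B. B \<in> K \<Longrightarrow> B \<subseteq> U - {y} \<Longrightarrow> rainbow f B"
    and "budget k K f U F"
    and "\<And>B u. B \<in> K \<Longrightarrow> \<not> rainbow f (B \<inter> U) \<Longrightarrow> u \<in> B \<Longrightarrow> u \<notin> U - {y} \<Longrightarrow>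
      rk (F u \<union> f ` (B \<inter> (U - {y}))) + card (B - (U - {y})) \<le> k"
    and "rk (F y) < rk (insert (f y) (F y))"
  shows "\<exists>K' F'. geometric_complex K' \<and> complex_refines K' K \<and> \<Union>K \<subseteq> \<Union>K' \<and>
      (\<forall>B\<in>K'. B \<subseteq> U \<longrightarrow> rainbow f B) \<and> budget k K' f U F' \<and>
      (\<forall>u\<in>\<Union>K. F' u = F u) \<and> (\<forall>z\<in>\<Union>K' - \<Union>K. rk (F y) < rk (F' z))"
  using assms
proof (induction "card {B \<in> K. B \<subseteq> U \<and> \<not> rainbow f B}" arbitrary: K F rule: less_induct)
  case less
  note gc = less.prems(1) and UK = less.prems(2) and y = less.prems(3) and a = less.prems(4)
    and b = less.prems(5) and c = less.prems(6) and d = less.prems(7)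
  note g = geometric_complexD[OF gc]
  let ?bad = "\<lambda>B. B \<in> K \<and> B \<subseteq> U \<and> \<not> rainbow f B"
  show ?case
  proof (cases "\<exists>B. ?bad B")
    case False
    then show ?thesis
      using gc b complex_refines_refl by (intro exI[of _ K] exI[of _ F]) auto
  next
    case True
    then obtain S where S: "?bad S" and Smin: "\<And>B. ?bad B \<Longrightarrow> card S \<le> card B"
      using exists_least_iff[of "\<lambda>n. \<exists>B. ?bad B \<and> card B = n"] by (metis not_less)
    have finS: "finite S" using g(2) S by blast
    have min: "rainbow f B" if "B \<in> K" "B \<subset> S" for B
      using Smin[of B] psubset_card_mono[OF finS \<open>B \<subset> S\<close>] that S by fastforce
    have yS: "y \<in> S" using a S by blast
    let ?R = "S - {y}" and ?G = "F y" and ?c = "f y" and ?U0 = "U - {y}"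
    have R: "rainbow f ?R" using min[of ?R] g(3)[of S ?R] S yS by blast
    have SR: "insert y ?R = S" using yS by blast
    have absorb: "rk (insert ?c (f ` ?R)) = rk (f ` ?R)"
      using R finS S SR by (intro rank_insert_not_rainbow) auto
    \<comment> \<open>Otherwise the label of \<open>y\<close> would have rank 0 and would lie in the
      span of \<open>F y\<close>. Hence \<open>S\<close> has at least two vertices and can be
      starred.\<close>
    have "?R \<noteq> {}"
    proof
      assume "?R = {}"
      from absorb[unfolded this] have "rk (insert ?c {}) = rk {}" by simp
      from rank_insert_absorb[OF this, of ?G] show False using d by simp
    qed
    then have "card ?R \<ge> 1" using finS by (simp add: Suc_leI card_gt_0_iff)
    then have card2: "card S \<ge> 2" using finS yS by simp
    define z where "z = barycenter S"
    define K1 where "K1 = star K S z"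
    define F1 where "F1 = F(z := ?G \<union> f ` ?R)"
    have zK: "z \<notin> \<Union>K" using barycenter_fresh[OF gc _ card2] S unfolding z_def by blast
    have zU: "z \<notin> U" using zK UK by blast
    have gc1: "geometric_complex K1" unfolding K1_def z_def
      using geometric_complex_star[OF gc _ card2] S by blast
    have ref1: "complex_refines K1 K" unfolding K1_def z_def
      using star_refines[OF gc _ card2] S by blast
    have U1: "\<Union>K1 = insert z (\<Union>K)" unfolding K1_def
      by (rule Union_star) (use g(3) S card2 in auto)
    have F1: "F1 u = F u" if "u \<in> \<Union>K" for u using that zK unfolding F1_def by auto
    have F1z: "F1 z = ?G \<union> f ` ?R" unfolding F1_def by simp
    have rainbow_new: "rainbow f (C \<inter> U)" if "C \<union> S \<in> K" "\<not> S \<subseteq> C" for C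
      by (rule rainbow_star_new[of K U y f S C]) (use g(2,3) a S yS min that in auto)
    \<comment> \<open>In \<open>C \<union> S\<close> the sharper budget counts \<open>y\<close> as
      one more unlabelled vertex. This extra unit pays for the new vertex \<open>z\<close>.\<close>
    have c1: "rk (F u \<union> f ` ((C \<union> S) \<inter> ?U0)) + Suc (card (C - U)) \<le> k"
      if C: "C \<union> S \<in> K" and u: "u \<in> C - U \<or> u = y" for C u
    proof -
      have "\<not> rainbow f ((C \<union> S) \<inter> U)" using S rainbow_subset[of f "(C \<union> S) \<inter> U" S] by blast
      then have "rk (F u \<union> f ` ((C \<union> S) \<inter> ?U0)) + card ((C \<union> S) - ?U0) \<le> k"
        using c[OF C] u yS by blast
      moreover have "(C \<union> S) - ?U0 = insert y (C - U)" using S yS by blast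
      moreover have "finite (C - U)" using g(2)[OF C] by simp
      ultimately show ?thesis using y by simp
    qed
    \<comment> \<open>Putting \<open>y\<close> back among the labelled vertices costs no rank, since
      its label lies in the span of the labels of \<open>S - {y}\<close>.\<close>
    have rk_new: "rk (X \<union> f ` ?R \<union> f ` (C \<inter> U)) \<le> rk (X \<union> f ` ((C \<union> S) \<inter> ?U0))" for X C
    proof -
      let ?Y = "X \<union> f ` ((C \<union> S) \<inter> ?U0)"
      have "f ` ?R \<subseteq> ?Y" using S by blast
      then have "rk (insert ?c ?Y) = rk ?Y" by (rule rank_insert_absorb[OF absorb])
      moreover have "X \<union> f ` ?R \<union> f ` (C \<inter> U) \<subseteq> insert ?c ?Y" using S by blast
      ultimately show ?thesis using rank_mono by metis
    qed
    have b1: "budget k K1 f U F1"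
      unfolding budget_def
    proof (intro ballI)
      fix B u assume B: "B \<in> K1" and u: "u \<in> B - U"
      from B[unfolded K1_def] show "rk (F1 u \<union> f ` (B \<inter> U)) + card (B - U) \<le> k"
      proof (cases rule: star_cases)
        case old
        then have "F1 u = F u" using u F1 by blast
        then show ?thesis using budgetD[OF b old(1)] u by simp
      next
        case (new C)
        have "z \<notin> C" using new(2) zK by blast
        have "B \<inter> U = C \<inter> U" "B - U = insert z (C - U)" using new(1) zU by blast+
        moreover have "finite (C - U)" using g(2)[OF new(2)] by simp
        ultimately have card: "card (B - U) = Suc (card (C - U))" and int: "B \<inter> U = C \<inter> U"
          using \<open>z \<notin> C\<close> by auto
        show ?thesis
        proof (cases "u = z")
          case True
          then show ?thesis
            using rk_new[of ?G C] c1[OF new(2), of y] unfolding card int F1z True by simp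
        next
          case False
          then have uC: "u \<in> C - U" using u new(1) by blast
          then have "F1 u = F u" using F1 new(2) by blast
          moreover have "rk (F u \<union> f ` (C \<inter> U)) \<le> rk (F u \<union> f ` ?R \<union> f ` (C \<inter> U))"
            by (intro rank_mono) blast
          ultimately show ?thesis
            using rk_new[of "F u" C] c1[OF new(2), of u] uC unfolding card int by simp
        qed
      qed
    qed
    have old: "B \<in> K \<and> \<not> S \<subseteq> B" if "B \<in> K1" "B \<subseteq> U" for B
      using \<open>B \<in> K1\<close>[unfolded K1_def] by (cases rule: star_cases) (use \<open>B \<subseteq> U\<close> zU in blast)+
    \<comment> \<open>A fully labelled simplex of \<open>K1\<close> avoids \<open>z\<close>, hence
      is old; and \<open>S\<close> itself has disappeared.\<close>
    have "{B \<in> K1. B \<subseteq> U \<and> \<not> rainbow f B} \<subset> {B. ?bad B}"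
      using old S by blast
    then have smaller: "card {B \<in> K1. B \<subseteq> U \<and> \<not> rainbow f B} < card {B. ?bad B}"
      using g(1) by (intro psubset_card_mono) auto
    \<comment> \<open>For a simplex containing \<open>z\<close> the condition is vacuous, its
      labelled part being rainbow.\<close>
    have cond_c: "rk (F1 u \<union> f ` (B \<inter> ?U0)) + card (B - ?U0) \<le> k"
      if B: "B \<in> K1" "\<not> rainbow f (B \<inter> U)" and u: "u \<in> B" "u \<notin> ?U0" for B u
      using B(1)[unfolded K1_def]
    proof (cases rule: star_cases)
      case old
      then have "F1 u = F u" using u F1 by blast
      then show ?thesis using c[OF old(1) B(2) u] by simp
    next
      case (new C)
      then have "B \<inter> U = C \<inter> U" using zU by blast
      then show ?thesis using rainbow_new[OF new(2,3)] B(2) by simp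
    qed
    have yK: "y \<in> \<Union>K" using y UK by blast
    have "\<exists>K' F'. geometric_complex K' \<and> complex_refines K' K1 \<and> \<Union>K1 \<subseteq> \<Union>K' \<and>
      (\<forall>B\<in>K'. B \<subseteq> U \<longrightarrow> rainbow f B) \<and> budget k K' f U F' \<and>
      (\<forall>u\<in>\<Union>K1. F' u = F1 u) \<and> (\<forall>z\<in>\<Union>K' - \<Union>K1. rk (F1 y) < rk (F' z))"
    proof (rule less.hyps[OF smaller gc1 _ y _ b1 cond_c])
      show "U \<subseteq> \<Union>K1" using UK U1 by blast
      show "rainbow f B" if "B \<in> K1" "B \<subseteq> ?U0" for B using a old that by blast
      show "rk (F1 y) < rk (insert (f y) (F1 y))" using d F1[OF yK] by simp
    qed
    then obtain K' F' where K': "geometric_complex K'" "complex_refines K' K1" "\<Union>K1 \<subseteq> \<Union>K'"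
      "\<forall>B\<in>K'. B \<subseteq> U \<longrightarrow> rainbow f B" "budget k K' f U F'"
      "\<forall>u\<in>\<Union>K1. F' u = F1 u" "\<forall>z\<in>\<Union>K' - \<Union>K1. rk (F1 y) < rk (F' z)"
      by (elim exE conjE)
    have rank_z: "rk ?G < rk (F1 z)"
    proof -
      have "rk (insert ?c (F1 z)) = rk (F1 z)"
        by (rule rank_insert_absorb[OF absorb]) (simp add: F1z)
      moreover have "rk (insert ?c ?G) \<le> rk (insert ?c (F1 z))"
        unfolding F1z by (intro rank_mono) blast
      ultimately show ?thesis using d by simp
    qed
    show ?thesis
    proof (intro exI[of _ K'] exI[of _ F'] conjI K' complex_refines_trans[OF K'(2) ref1])
      show "\<Union>K \<subseteq> \<Union>K'" using K'(3) U1 by blast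
      show "\<forall>u\<in>\<Union>K. F' u = F u" using K'(6) U1 F1 by simp
      show "\<forall>x\<in>\<Union>K' - \<Union>K. rk (F y) < rk (F' x)"
      proof
        fix x assume x: "x \<in> \<Union>K' - \<Union>K"
        show "rk (F y) < rk (F' x)"
        proof (cases "x = z")
          case True
          then show ?thesis using K'(6) U1 rank_z by simp
        next
          case False
          then have "x \<in> \<Union>K' - \<Union>K1" using x U1 by simp
          then have "rk (F1 y) < rk (F' x)" using K'(7) by blast
          then show ?thesis using F1[OF yK] by simp
        qed
      qed
    qed
  qed
qed

text \<open>\<open>L v\<close> is the set of labels allowed at \<open>v\<close>, and
  \<open>U\<close> the set of vertices labelled so far. Each round labels one more vertex and
  repairs the complex around it. The recursion is well-founded for the multiset of the defects
  \<open>k - rk (F u)\<close> of the unlabelled vertices.\<close>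

lemma rainbow_refinement:
  fixes K :: "'a::euclidean_space set set" and L :: "'a \<Rightarrow> 'w set"
  assumes k: "rk carrier = k"
    and L: "\<And>v. v \<in> P \<Longrightarrow> rk (L v) = k"
    and "geometric_complex K" "\<And>A. A \<in> K \<Longrightarrow> convex hull A \<subseteq> P" "U \<subseteq> \<Union>K"
    and "\<And>B. B \<in> K \<Longrightarrow> B \<subseteq> U \<Longrightarrow> rainbow f B" "budget k K f U F" "\<And>v. v \<in> U \<Longrightarrow> f v \<in> L v"
  shows "\<exists>K' f'. geometric_complex K' \<and> complex_refines K' K \<and> (\<forall>B\<in>K'. rainbow f' B) \<and>
      (\<forall>v\<in>\<Union>K'. f' v \<in> L v)"
  using assms(3-)
proof (induction "image_mset (\<lambda>u. k - rk (F u)) (mset_set (\<Union>K - U))" arbitrary: K f U F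
    rule: wf_induct_rule[OF wf_mult1[OF wf_less_than]])
  case (1 K U F f)
  note gc = "1.prems"(1) and KP = "1.prems"(2) and UK = "1.prems"(3) and a = "1.prems"(4)
    and b = "1.prems"(5) and fL = "1.prems"(6)
  note g = geometric_complexD[OF gc]
  show ?case
  proof (cases "\<Union>K \<subseteq> U")
    case True
    then show ?thesis
      using gc a fL complex_refines_refl by (intro exI[of _ K] exI[of _ f]) blast
  next
    case False
    then obtain y where y: "y \<in> \<Union>K" "y \<notin> U" by blast
    have yK: "{y} \<in> K" using y(1) g(3) by blast
    have yP: "y \<in> P" using KP[OF yK] by simp
    have yU: "{y} - U = {y}" "{y} \<inter> U = {}" using y(2) by blast+
    \<comment> \<open>The budget of the single vertex \<open>y\<close> is
      \<open>rk (F y) + 1 \<le> k\<close>, so \<open>F y\<close> does not span and an allowed label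
      lies outside its span.\<close>
    have "rk (F y) < k" using budgetD[OF b yK _ y(2)] unfolding yU by simp
    then obtain c where c: "c \<in> L y" "rk (F y) < rk (insert c (F y))"
      using rank_increasing_element[of "F y" "L y"] L[OF yP] by auto
    define f1 where "f1 = f(y := c)"
    define U1 where "U1 = insert y U"
    have U1y: "U1 - {y} = U" using y(2) unfolding U1_def by blast
    have f1: "f1 ` X = f ` X" if "y \<notin> X" for X using that unfolding f1_def by auto
    have f1U: "f1 ` (B \<inter> U) = f ` (B \<inter> U)" for B using y(2) by (intro f1) blast
    have rb: "rainbow f1 B" if "B \<in> K" "B \<subseteq> U" for B
    proof -
      have "y \<notin> B" using that y(2) by blast
      moreover from this have "inj_on f1 B = inj_on f B"
        unfolding f1_def by (intro inj_on_cong) auto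
      ultimately show ?thesis using a[OF that] f1[of B] unfolding rainbow_def by simp
    qed
    \<comment> \<open>Labelling \<open>y\<close> raises the rank by at most one, while in simplices
      containing \<open>y\<close> the number of unlabelled vertices drops by one.\<close>
    have b1: "budget k K f1 U1 F"
      unfolding budget_def
    proof (intro ballI)
      fix B u assume B: "B \<in> K" and u: "u \<in> B - U1"
      have bu: "rk (F u \<union> f ` (B \<inter> U)) + card (B - U) \<le> k"
        using budgetD[OF b B] u unfolding U1_def by blast
      show "rk (F u \<union> f1 ` (B \<inter> U1)) + card (B - U1) \<le> k"
      proof (cases "y \<in> B")
        case True
        have "B - U = insert y (B - U1)" "y \<notin> B - U1" using True y(2) unfolding U1_def by blast+
        then have "card (B - U) = Suc (card (B - U1))" using g(2)[OF B] by simp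
        moreover have "F u \<union> f1 ` (B \<inter> U1) = insert (f1 y) (F u \<union> f1 ` (B \<inter> U))"
          using True unfolding U1_def by blast
        ultimately show ?thesis
          using bu rank_insert_le[of "f1 y" "F u \<union> f ` (B \<inter> U)"] unfolding f1U by simp
      next
        case False
        then have "B \<inter> U1 = B \<inter> U" "B - U1 = B - U" unfolding U1_def by blast+
        then show ?thesis using bu f1U by simp
      qed
    qed
    have "\<exists>K' F'. geometric_complex K' \<and> complex_refines K' K \<and> \<Union>K \<subseteq> \<Union>K' \<and>
      (\<forall>B\<in>K'. B \<subseteq> U1 \<longrightarrow> rainbow f1 B) \<and> budget k K' f1 U1 F' \<and>
      (\<forall>u\<in>\<Union>K. F' u = F u) \<and> (\<forall>z\<in>\<Union>K' - \<Union>K. rk (F y) < rk (F' z))"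
    proof (rule rainbow_around_vertex[OF gc _ _ _ b1])
      show "U1 \<subseteq> \<Union>K" "y \<in> U1" using UK y(1) unfolding U1_def by blast+
      show "rainbow f1 B" if "B \<in> K" "B \<subseteq> U1 - {y}" for B using rb that U1y by simp
      \<comment> \<open>The sharper budget is the budget before \<open>y\<close> was labelled, and
        so holds for every simplex, rainbow or not.\<close>
      show "rk (F u \<union> f1 ` (B \<inter> (U1 - {y}))) + card (B - (U1 - {y})) \<le> k"
        if "B \<in> K" "u \<in> B" "u \<notin> U1 - {y}" for B u
        using budgetD[OF b that(1,2)] that(3) unfolding U1y f1U by simp
      show "rk (F y) < rk (insert (f1 y) (F y))" using c(2) unfolding f1_def by simp
    qed
    then obtain K' F' where K': "geometric_complex K'" "complex_refines K' K" "\<Union>K \<subseteq> \<Union>K'"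
      "\<forall>B\<in>K'. B \<subseteq> U1 \<longrightarrow> rainbow f1 B" "budget k K' f1 U1 F'"
      "\<forall>u\<in>\<Union>K. F' u = F u" "\<forall>z\<in>\<Union>K' - \<Union>K. rk (F y) < rk (F' z)"
      by (elim exE conjE)
    define M where "M = (\<lambda>F (u::'a). k - rk (F u))"
    let ?old = "\<Union>K - U1" and ?new = "\<Union>K' - \<Union>K"
    have fins: "finite ?old" "finite ?new" using g(4) geometric_complexD(4)[OF K'(1)] by auto
    have "\<Union>K - U = insert y ?old" "y \<notin> ?old" using y unfolding U1_def by blast+
    then have before: "image_mset (M F) (mset_set (\<Union>K - U)) = image_mset (M F) (mset_set ?old) + {#M F y#}"
      using fins(1) by simp
    have "\<Union>K' - U1 = ?old \<union> ?new" using K'(3) UK y(1) unfolding U1_def by blast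
    moreover have "mset_set (?old \<union> ?new) = mset_set ?old + mset_set ?new"
      using fins by (intro mset_set_Union) auto
    moreover have "image_mset (M F') (mset_set ?old) = image_mset (M F) (mset_set ?old)"
      using K'(6) fins(1) by (intro image_mset_cong) (auto simp: M_def)
    ultimately have after: "image_mset (M F') (mset_set (\<Union>K' - U1)) =
        image_mset (M F) (mset_set ?old) + image_mset (M F') (mset_set ?new)"
      by simp
    have "M F' z < M F y" if "z \<in> ?new" for z
    proof -
      have "rk (F y) < rk (F' z)" using K'(7) that by blast
      moreover have "rk (F' z) \<le> k" using rank_le_rank_carrier k by simp
      ultimately show ?thesis unfolding M_def by simp
    qed
    then have new_less: "\<And>b. b \<in># image_mset (M F') (mset_set ?new) \<Longrightarrow> (b, M F y) \<in> less_than"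
      using fins(2) by auto
    \<comment> \<open>One step of the multiset order: the defect of \<open>y\<close> is replaced by
      the finitely many smaller defects of the new vertices, and all other defects are kept.\<close>
    have decr: "(image_mset (M F') (mset_set (\<Union>K' - U1)), image_mset (M F) (mset_set (\<Union>K - U)))
        \<in> mult1 less_than"
      by (rule mult1I[OF _ after new_less]) (simp add: before)
    have "\<exists>K'' f'. geometric_complex K'' \<and> complex_refines K'' K' \<and> (\<forall>B\<in>K''. rainbow f' B) \<and>
      (\<forall>v\<in>\<Union>K''. f' v \<in> L v)"
    proof (rule "1.hyps"[OF decr[unfolded M_def] K'(1) _ _ _ K'(5)])
      show "convex hull A \<subseteq> P" if A: "A \<in> K'" for A
        by (rule complex_refinesE1[OF K'(2) A]) (meson KP subset_trans)
      show "U1 \<subseteq> \<Union>K'" using UK y(1) K'(3) unfolding U1_def by blast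
      show "rainbow f1 B" if "B \<in> K'" "B \<subseteq> U1" for B using K'(4) that by blast
      show "f1 v \<in> L v" if "v \<in> U1" for v using that fL c(1) unfolding U1_def f1_def by auto
    qed
    then obtain K'' f' where K'': "geometric_complex K''" "complex_refines K'' K'"
      "\<forall>B\<in>K''. rainbow f' B" "\<forall>v\<in>\<Union>K''. f' v \<in> L v"
      by (elim exE conjE)
    then show ?thesis
      using complex_refines_trans[OF K''(2) K'(2)] by (intro exI[of _ K''] exI[of _ f'] conjI)
  qed
qed

end

section \<open>Available labels and assembly of the refinement\<close>

lemma supp_nonempty_face:
  fixes P :: "'a::euclidean_space set"
  assumes "convex P" "v \<in> P"
  shows "supp P v \<in> nonempty_faces P" "v \<in> supp P v"
proof -
  have "supp P v face_of P"
    unfolding supp_eq_Inter[OF assms]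
    by (rule face_of_Inter) (use assms face_of_refl in auto)
  then show "v \<in> supp P v" "supp P v \<in> nonempty_faces P"
    using supp_eq_Inter[OF assms] unfolding nonempty_faces_def by auto
qed

text \<open>The labels available at a point span the matroid: otherwise their complement would have to
  cover that point.\<close>

lemma rank_available_labels:
  fixes P :: "'a::euclidean_space set"
  assumes "matroid W indep" "matroid_rank indep W = k" "convex P" "v \<in> P"
    and cover: "matroid_komiya_cover k W indep P A"
  defines "L \<equiv> {w \<in> W. \<exists>\<sigma>\<in>nonempty_faces P. \<sigma> \<subseteq> supp P v \<and> v \<in> A w \<sigma>}"
  shows "matroid_rank indep L = k"
proof (rule ccontr)
  interpret matroid W indep by fact
  assume "rk L \<noteq> k"
  \<comment> \<open>The complement of \<open>W - L\<close> in \<open>W\<close> is \<open>L\<close>,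
    so \<open>W - L\<close> is an admissible choice of \<open>G\<close> in the cover
    condition.\<close>
  then have "rk L \<le> k - 1" using rank_le_rank_carrier[of L] assms(2) by simp
  moreover have "W - (W - L) = L" unfolding L_def by auto
  ultimately have "komiya_cover P (\<lambda>\<sigma>. \<Union>w\<in>W - L. A w \<sigma>)"
    using cover unfolding matroid_komiya_cover_def by (metis Diff_subset)
  then have "supp P v \<subseteq> (\<Union>\<sigma>\<in>{\<sigma> \<in> nonempty_faces P. \<sigma> \<subseteq> supp P v}. \<Union>w\<in>W - L. A w \<sigma>)"
    using supp_nonempty_face(1)[OF assms(3,4)] unfolding komiya_cover_def by blast
  then obtain \<sigma> w where "\<sigma> \<in> nonempty_faces P" "\<sigma> \<subseteq> supp P v" "w \<in> W - L" "v \<in> A w \<sigma>"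
    using supp_nonempty_face(2)[OF assms(3,4)] by blast
  then show False unfolding L_def by blast
qed

theorem theorem4p3:
  fixes k :: nat
    and P :: "'a::euclidean_space set" and p :: 'a
    and W :: "'w set" and indep :: "'w set \<Rightarrow> bool"
    and pt :: "'w \<Rightarrow> 'a set \<Rightarrow> 'a"
    and A :: "'w \<Rightarrow> 'a set \<Rightarrow> 'a set"
    and T :: "'a set set"
  assumes "k \<ge> 2"
    and "polytope P" and "aff_dim P = int k - 1" and "p \<in> P"
    and "matroid W indep" and "matroid_rank indep W = k"
    and "\<forall>\<tau>\<in>nonempty_faces P. \<forall>w\<in>W. pt w \<tau> \<in> \<tau>"
    and "matroid_komiya_cover k W indep P A"
    and "triangulation_of P T"
  shows "\<exists>T' lab f y.
      triangulation_of P T' \<and> triangulation_refines T' T \<and>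
      lab \<in> triangulation_vertices T' \<rightarrow> nonempty_faces P \<and>
      f \<in> triangulation_vertices T' \<rightarrow> W \<and>
      y \<in> triangulation_vertices T' \<rightarrow> P \<and>
      (\<forall>v\<in>triangulation_vertices T'. v \<in> A (f v) (lab v)) \<and>
      (\<forall>v\<in>triangulation_vertices T'.
         y v = pt (f v) (lab v) \<and> y v \<in> lab v \<and> lab v \<subseteq> supp P v) \<and>
      (\<forall>\<tau>\<in>T'. inj_on f (simplex_vertices \<tau>) \<and> indep (f ` simplex_vertices \<tau>) \<and>
         (card (simplex_vertices \<tau>) = k \<longrightarrow> matroid_basis indep (f ` simplex_vertices \<tau>))) \<and>
      sperner_shapley_labeling P T' lab"
proof -
  interpret matroid W indep by fact
  have convP: "convex P" using \<open>polytope P\<close> polytope_imp_convex by blast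
  have T: "simplicial_complex T" "\<Union>T = P"
    using \<open>triangulation_of P T\<close> unfolding triangulation_of_def by auto
  define K where "K = simplex_vertices ` T"
  have gc: "geometric_complex K" and KT: "(hull) convex ` K = T"
    unfolding K_def using geometric_complex_of_simplicial_complex[OF T(1)] by auto
  have KP: "convex hull B \<subseteq> P" if "B \<in> K" for B
    using that KT T(2) by (metis Union_upper imageI)
  \<comment> \<open>An affinely independent set in a space of dimension \<open>k - 1\<close> has at
    most \<open>k\<close> points. This bound is the initial budget.\<close>
  have card: "card B \<le> k" if "B \<in> K" for B
  proof -
    have "B \<subseteq> P" using KP[OF that] hull_subset[of B convex] by simp
    then have "aff_dim B \<le> int k - 1" using aff_dim_subset \<open>aff_dim P = int k - 1\<close> by metis
    then show ?thesis
      using aff_dim_affine_independent[OF geometric_complex_affine_independent[OF gc that]] by simp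
  qed
  define L where "L = (\<lambda>v. {w \<in> W. \<exists>\<sigma>\<in>nonempty_faces P. \<sigma> \<subseteq> supp P v \<and> v \<in> A w \<sigma>})"
  have rkL: "rk (L v) = k" if "v \<in> P" for v
    unfolding L_def using rank_available_labels assms convP that by blast
  have "rk {} = 0" using rank_indep[OF indep_empty] by simp
  \<comment> \<open>At the start no vertex is labelled, so the labelling may be
    \<open>undefined\<close>, and all forbidden sets are empty.\<close>
  then have "budget k K undefined {} (\<lambda>_. {})"
    unfolding budget_def using card by simp
  then have "\<exists>K' f'. geometric_complex K' \<and> complex_refines K' K \<and> (\<forall>B\<in>K'. rainbow f' B) \<and>
      (\<forall>v\<in>\<Union>K'. f' v \<in> L v)"
    using \<open>matroid_rank indep W = k\<close> rkL gc KP indep_empty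
    by (intro rainbow_refinement[where P = P and U = "{}"]) (auto simp: rainbow_def)
  then obtain K' f where K': "geometric_complex K'" and ref: "complex_refines K' K"
    and rb: "\<forall>B\<in>K'. rainbow f B" and f: "\<forall>v\<in>\<Union>K'. f v \<in> L v"
    by (elim exE conjE)
  define T' where "T' = (hull) convex ` K'"
  have vert: "simplex_vertices (convex hull B) = B" if "B \<in> K'" for B
    using simplex_vertices_hull geometric_complex_affine_independent[OF K' that] .
  have V: "triangulation_vertices T' = \<Union>K'"
    unfolding triangulation_vertices_def T'_def using vert by simp
  have refT: "triangulation_refines T' T"
    unfolding triangulation_refines_def
  proof (intro conjI ballI)
    fix \<tau>' assume "\<tau>' \<in> T'"
    then obtain B where B: "B \<in> K'" "\<tau>' = convex hull B" unfolding T'_def by blast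
    show "\<exists>\<tau>\<in>T. \<tau>' \<subseteq> \<tau>"
      by (rule complex_refinesE1[OF ref B(1)]) (use KT B(2) in blast)
  next
    fix \<tau> assume "\<tau> \<in> T"
    then obtain B where B: "B \<in> K" "\<tau> = convex hull B" using KT by blast
    have "\<tau> \<subseteq> \<Union>{\<tau>' \<in> T'. \<tau>' \<subseteq> \<tau>}"
    proof
      fix p assume "p \<in> \<tau>"
      then have p: "p \<in> convex hull B" using B(2) by simp
      show "p \<in> \<Union>{\<tau>' \<in> T'. \<tau>' \<subseteq> \<tau>}"
        by (rule complex_refinesE2[OF ref B(1) p]) (use B(2) in \<open>auto simp: T'_def\<close>)
    qed
    then have "\<tau> = \<Union>{\<tau>' \<in> T'. \<tau>' \<subseteq> \<tau>}" by auto
    then show "\<exists>F\<subseteq>T'. \<tau> = \<Union>F" by (intro exI[of _ "{\<tau>' \<in> T'. \<tau>' \<subseteq> \<tau>}"]) auto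
  qed
  have "\<Union>T' = \<Union>T"
  proof
    show "\<Union>T' \<subseteq> \<Union>T" using refT unfolding triangulation_refines_def by (meson Union_iff subsetD subsetI)
    show "\<Union>T \<subseteq> \<Union>T'" using refT unfolding triangulation_refines_def by (metis Sup_least Union_mono)
  qed
  then have triT: "triangulation_of P T'"
    unfolding triangulation_of_def T'_def using simplicial_complex_hulls[OF K'] T(2) by simp
  \<comment> \<open>The face is chosen only now, after the matroid label: membership in
    \<open>L v\<close> guarantees its existence.\<close>
  have "\<forall>v\<in>\<Union>K'. \<exists>\<sigma>. \<sigma> \<in> nonempty_faces P \<and> \<sigma> \<subseteq> supp P v \<and> v \<in> A (f v) \<sigma>"
    using f unfolding L_def by blast
  then obtain lab where lab: "\<forall>v\<in>\<Union>K'. lab v \<in> nonempty_faces P \<and> lab v \<subseteq> supp P v \<and> v \<in> A (f v) (lab v)"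
    by metis
  have fW: "f v \<in> W" if "v \<in> \<Union>K'" for v using f that unfolding L_def by blast
  define y where "y = (\<lambda>v. pt (f v) (lab v))"
  have y: "y v \<in> lab v" if "v \<in> \<Union>K'" for v
    unfolding y_def using assms(7) lab fW that by blast
  have labP: "lab v \<subseteq> P" if "v \<in> \<Union>K'" for v
    using lab that face_of_imp_subset unfolding nonempty_faces_def by blast
  have basis: "matroid_basis indep (f ` B)" if "B \<in> K'" "card B = k" for B
    unfolding matroid_basis_def
  proof (intro conjI allI impI)
    have B: "inj_on f B" "indep (f ` B)" using rb that(1) unfolding rainbow_def by auto
    show "indep (f ` B)" by fact
    fix I assume I: "indep I \<and> f ` B \<subseteq> I"
    then have "card I \<le> card (f ` B)"
      using card_le_rank[of I W] indep_subset_carrier card_image[OF B(1)] that(2) assms(6) by simp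
    then show "I = f ` B" using I card_seteq finite_indep by metis
  qed
  show ?thesis
  proof (intro exI[of _ T'] exI[of _ lab] exI[of _ f] exI[of _ y] conjI triT refT)
    show "lab \<in> triangulation_vertices T' \<rightarrow> nonempty_faces P" unfolding V using lab by blast
    show "f \<in> triangulation_vertices T' \<rightarrow> W" unfolding V using fW by blast
    show "y \<in> triangulation_vertices T' \<rightarrow> P" unfolding V using y labP by blast
    show "\<forall>v\<in>triangulation_vertices T'. v \<in> A (f v) (lab v)" using lab V by simp
    show "\<forall>v\<in>triangulation_vertices T'. y v = pt (f v) (lab v) \<and> y v \<in> lab v \<and> lab v \<subseteq> supp P v"
      using lab y V y_def by simp
    show "\<forall>\<tau>\<in>T'. inj_on f (simplex_vertices \<tau>) \<and> indep (f ` simplex_vertices \<tau>) \<and>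
         (card (simplex_vertices \<tau>) = k \<longrightarrow> matroid_basis indep (f ` simplex_vertices \<tau>))"
      unfolding T'_def using rb basis by (auto simp: vert rainbow_def)
    show "sperner_shapley_labeling P T' lab"
      unfolding sperner_shapley_labeling_def using lab V by simp
  qed
qed

end
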